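(* Let $$\begin{array}{ccc}\mathbf{D}&\xrightarrow{\;F'\;}&\mathbf{B}\\ {\scriptstyle G'}\downarrow&&\downarrow{\scriptstyle G}\\ \mathbf{A}&\xrightarrow{\;F\;}&\mathbf{C}\end{array}$$ be a pullback square in the category $\mathbf{Cat}$ of small categories and functors. Suppose that all four categories are finely finite, that $G$ is ULF, and that $F$ is bijective on objects and has finite fibres. Then $G'$ is ULF, $F'$ is bijective on objects and has finite fibres, and for all rigs $k$ the square of $k$-linear maps $$\begin{array}{ccc}k\mathbf{D}&\xrightarrow{\;F'_!\;}&k\mathbf{B}\\ {\scriptstyle G'^*}\uparrow&&\uparrow{\scriptstyle G^*}\\ k\mathbf{A}&\xrightarrow{\;F_!\;}&k\mathbf{C}\end{array}$$ commutes, i.e. $G^*\circ F_!=F'_!\circ G'^*$.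
   Context: A rig is a set with a commutative monoid structure $(+,0)$ and a commutative monoid structure $(\cdot,1)$, the latter distributing over the former (including $0\cdot x=0$). A category $\mathbf{A}$ is finely finite if for each map $f:a\to b$ there are only finitely many pairs of composable maps $a\xrightarrow{g}c\xrightarrow{h}b$ with $hg=f$. For such $\mathbf{A}$, with set of maps $\mathbf{A}_1$, the fine incidence algebra $k\mathbf{A}$ is the set of functions $\mathbf{A}_1\to k$ with pointwise $k$-module structure and product $(\alpha*\beta)(f)=\sum_{hg=f}\alpha(g)\beta(h)$; the unit is $1$ on identities and $0$ on other maps. A functor $F:\mathbf{A}\to\mathbf{B}$ is ULF (has unique lifting of factorizations) if whenever $f$ is a map in $\mathbf{A}$ and $Ff=g_2\circ g_1$ in $\mathbf{B}$, there are unique maps $f_1,f_2$ in $\mathbf{A}$ with $f_2\circ f_1=f$, $Ff_1=g_1$, $Ff_2=g_2$. It has finite fibres if for each map $g$ of $\mathbf{B}$ the set of maps $f$ of $\mathbf{A}$ with $Ff=g$ is finite. It is bijective on objects if its object function is a bijection. For a functor $F:\mathbf{A}\to\mathbf{B}$ between finely finite categories, $F^*:k\mathbf{B}\to k\mathbf{A}$ is $(F^*\beta)(f)=\beta(Ff)$. If $F$ has finite fibres, $F_!:k\mathbf{A}\to k\mathbf{B}$ is $(F_!\alpha)(g)=\sum_{f:\,Ff=g}\alpha(f)$. *)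

theory Defs
  imports "HOL-Algebra.Module" "HOL-Library.Infinite_Typeclass"
begin

section \<open>Rigs\<close>

text \<open>
  The library class \<open>comm_semiring_1\<close> requires \<open>0 \<noteq> 1\<close>; a rig may be trivial.
\<close>

class rig = comm_semiring_0 + comm_monoid_mult

context comm_semiring_1
begin
subclass rig ..
end


section \<open>Categories and functors\<close>

text \<open>
  Only the values of \<open>Dom\<close>, \<open>Cod\<close> on \<open>Arr\<close>, of \<open>Idn\<close> on \<open>Obj\<close>, and of \<open>Comp\<close> on
  composable pairs are meaningful; \<open>Comp C h g\<close> is the composite $h \circ g$.
\<close>

record ('o, 'm) cat_data =
  Obj :: "'o set"
  Arr :: "'m set"
  Dom :: "'m \<Rightarrow> 'o"
  Cod :: "'m \<Rightarrow> 'o"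
  Idn :: "'o \<Rightarrow> 'm"
  Comp :: "'m \<Rightarrow> 'm \<Rightarrow> 'm"

locale category =
  fixes C :: "('o, 'm) cat_data"
  assumes Dom_in_Obj: "f \<in> Arr C \<Longrightarrow> Dom C f \<in> Obj C"
    and Cod_in_Obj: "f \<in> Arr C \<Longrightarrow> Cod C f \<in> Obj C"
    and Idn_in_Arr: "a \<in> Obj C \<Longrightarrow> Idn C a \<in> Arr C"
    and Dom_Idn: "a \<in> Obj C \<Longrightarrow> Dom C (Idn C a) = a"
    and Cod_Idn: "a \<in> Obj C \<Longrightarrow> Cod C (Idn C a) = a"
    and Comp_in_Arr:
      "\<lbrakk>g \<in> Arr C; h \<in> Arr C; Cod C g = Dom C h\<rbrakk> \<Longrightarrow> Comp C h g \<in> Arr C"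
    and Dom_Comp:
      "\<lbrakk>g \<in> Arr C; h \<in> Arr C; Cod C g = Dom C h\<rbrakk> \<Longrightarrow> Dom C (Comp C h g) = Dom C g"
    and Cod_Comp:
      "\<lbrakk>g \<in> Arr C; h \<in> Arr C; Cod C g = Dom C h\<rbrakk> \<Longrightarrow> Cod C (Comp C h g) = Cod C h"
    and Comp_Idn_right: "f \<in> Arr C \<Longrightarrow> Comp C f (Idn C (Dom C f)) = f"
    and Comp_Idn_left: "f \<in> Arr C \<Longrightarrow> Comp C (Idn C (Cod C f)) f = f"
    and Comp_assoc:
      "\<lbrakk>f \<in> Arr C; g \<in> Arr C; h \<in> Arr C; Cod C f = Dom C g; Cod C g = Dom C h\<rbrakk>
        \<Longrightarrow> Comp C h (Comp C g f) = Comp C (Comp C h g) f"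

record ('o, 'm, 'p, 'n) functor_data =
  Src :: "('o, 'm) cat_data"
  Tgt :: "('p, 'n) cat_data"
  ObjMap :: "'o \<Rightarrow> 'p"
  ArrMap :: "'m \<Rightarrow> 'n"

text \<open>
  The object and arrow maps are extensional, so that equality of functors is equality of
  records.
\<close>

definition is_functor :: "('o, 'm, 'p, 'n) functor_data \<Rightarrow> bool" where
  "is_functor F \<longleftrightarrow>
     category (Src F) \<and> category (Tgt F) \<and>
     ObjMap F \<in> Obj (Src F) \<rightarrow>\<^sub>E Obj (Tgt F) \<and>
     ArrMap F \<in> Arr (Src F) \<rightarrow>\<^sub>E Arr (Tgt F) \<and>
     (\<forall>f \<in> Arr (Src F). Dom (Tgt F) (ArrMap F f) = ObjMap F (Dom (Src F) f)) \<and>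
     (\<forall>f \<in> Arr (Src F). Cod (Tgt F) (ArrMap F f) = ObjMap F (Cod (Src F) f)) \<and>
     (\<forall>a \<in> Obj (Src F). ArrMap F (Idn (Src F) a) = Idn (Tgt F) (ObjMap F a)) \<and>
     (\<forall>g \<in> Arr (Src F). \<forall>h \<in> Arr (Src F). Cod (Src F) g = Dom (Src F) h \<longrightarrow>
        ArrMap F (Comp (Src F) h g) = Comp (Tgt F) (ArrMap F h) (ArrMap F g))"

definition functor_id :: "('o, 'm) cat_data \<Rightarrow> ('o, 'm, 'o, 'm) functor_data" where
  "functor_id C =
     \<lparr>Src = C, Tgt = C, ObjMap = restrict id (Obj C), ArrMap = restrict id (Arr C)\<rparr>"

definition functor_comp ::
  "('p, 'n, 'q, 'r) functor_data \<Rightarrow> ('o, 'm, 'p, 'n) functor_data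
    \<Rightarrow> ('o, 'm, 'q, 'r) functor_data" where
  "functor_comp G F =
     \<lparr>Src = Src F, Tgt = Tgt G,
      ObjMap = restrict (ObjMap G \<circ> ObjMap F) (Obj (Src F)),
      ArrMap = restrict (ArrMap G \<circ> ArrMap F) (Arr (Src F))\<rparr>"


section \<open>The category of small categories\<close>

text \<open>
  The type \<open>'u\<close> plays the role of the universe: a category is small if its objects and its
  maps are elements of \<open>'u\<close>. For infinite \<open>'u\<close> these categories are closed under pullbacks,
  and every set of categories embeds into such a universe up to isomorphism.
\<close>

type_synonym 'u small_cat = "('u, 'u) cat_data"
type_synonym 'u small_functor = "('u, 'u, 'u, 'u) functor_data"

definition CAT :: "('u small_cat, 'u small_functor) cat_data" where
  "CAT = \<lparr>Obj = {C. category C}, Arr = {F. is_functor F}, Dom = Src, Cod = Tgt,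
          Idn = functor_id, Comp = functor_comp\<rparr>"

lemma category_CAT: "category CAT"
proof
  show "\<lbrakk>f \<in> Arr CAT\<rbrakk> \<Longrightarrow> Comp CAT f (Idn CAT (Dom CAT f)) = f" for f :: "'a small_functor"
    by (auto simp: CAT_def is_functor_def functor_comp_def functor_id_def PiE_def intro!: functor_data.equality ext)
       (auto simp: extensional_def restrict_def)
  show "\<lbrakk>f \<in> Arr CAT\<rbrakk> \<Longrightarrow> Comp CAT (Idn CAT (Cod CAT f)) f = f" for f :: "'a small_functor"
    by (auto simp: CAT_def is_functor_def functor_comp_def functor_id_def PiE_def Pi_def intro!: functor_data.equality ext)
       (auto simp: extensional_def restrict_def)
  show "Idn CAT a \<in> Arr CAT" if "a \<in> Obj CAT" for a :: "'a small_cat"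
    using that by (auto simp: CAT_def is_functor_def functor_id_def category_def)
  show "Comp CAT h g \<in> Arr CAT"
    if "g \<in> Arr CAT" "h \<in> Arr CAT" "Cod CAT g = Dom CAT h" for g h :: "'a small_functor"
  proof -
    have "is_functor g" "is_functor h" and [simp]: "Tgt g = Src h"
      using that by (simp_all add: CAT_def)
    moreover have "ObjMap g a \<in> Obj (Src h)" if "a \<in> Obj (Src g)" for a
      using \<open>is_functor g\<close> that by (auto simp: is_functor_def)
    moreover have "ArrMap g f \<in> Arr (Src h)" if "f \<in> Arr (Src g)" for f
      using \<open>is_functor g\<close> that by (auto simp: is_functor_def)
    ultimately have "is_functor (functor_comp h g)"
      by (simp add: is_functor_def functor_comp_def category.Dom_in_Obj category.Cod_in_Obj
          category.Idn_in_Arr category.Comp_in_Arr PiE_iff)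
    then show ?thesis by (simp add: CAT_def)
  qed
  show "Comp CAT h (Comp CAT g f) = Comp CAT (Comp CAT h g) f" if "f \<in> Arr CAT" "g \<in> Arr CAT" "h \<in> Arr CAT" "Cod CAT f = Dom CAT g" "Cod CAT g = Dom CAT h" for f g h :: "'a small_functor"
    using that by (auto simp: CAT_def is_functor_def functor_comp_def PiE_mem intro!: functor_data.equality ext)
qed (auto simp: CAT_def is_functor_def functor_id_def functor_comp_def)

text \<open>
  \<open>pullback_square K p q f g\<close> says that the commutative square with $f p = g q$
  is a pullback in \<open>K\<close>: here $p$, $q$ are the projections and $f$, $g$ the given cospan.
\<close>

definition pullback_square ::
  "('o, 'm) cat_data \<Rightarrow> 'm \<Rightarrow> 'm \<Rightarrow> 'm \<Rightarrow> 'm \<Rightarrow> bool" where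
  "pullback_square K p q f g \<longleftrightarrow>
     p \<in> Arr K \<and> q \<in> Arr K \<and> f \<in> Arr K \<and> g \<in> Arr K \<and>
     Dom K p = Dom K q \<and> Cod K p = Dom K f \<and> Cod K q = Dom K g \<and> Cod K f = Cod K g \<and>
     Comp K f p = Comp K g q \<and>
     (\<forall>s \<in> Arr K. \<forall>t \<in> Arr K.
        Dom K s = Dom K t \<and> Cod K s = Dom K f \<and> Cod K t = Dom K g \<and>
        Comp K f s = Comp K g t \<longrightarrow>
        (\<exists>!u. u \<in> Arr K \<and> Dom K u = Dom K s \<and> Cod K u = Dom K p \<and>
              Comp K p u = s \<and> Comp K q u = t))"


section \<open>Finiteness and lifting conditions\<close>

text \<open>Factorizations $f = h g$ are recorded as pairs \<open>(g, h)\<close>, in diagrammatic order.\<close>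

definition factorizations :: "('o, 'm) cat_data \<Rightarrow> 'm \<Rightarrow> ('m \<times> 'm) set" where
  "factorizations C f =
     {(g, h). g \<in> Arr C \<and> h \<in> Arr C \<and> Cod C g = Dom C h \<and> Comp C h g = f}"

definition finely_finite :: "('o, 'm) cat_data \<Rightarrow> bool" where
  "finely_finite C \<longleftrightarrow> category C \<and> (\<forall>f \<in> Arr C. finite (factorizations C f))"

definition ULF :: "('o, 'm, 'p, 'n) functor_data \<Rightarrow> bool" where
  "ULF F \<longleftrightarrow>
     (\<forall>f \<in> Arr (Src F). \<forall>(g1, g2) \<in> factorizations (Tgt F) (ArrMap F f).
        \<exists>!(f1, f2). (f1, f2) \<in> factorizations (Src F) f \<and>
                    ArrMap F f1 = g1 \<and> ArrMap F f2 = g2)"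

definition fibre :: "('o, 'm, 'p, 'n) functor_data \<Rightarrow> 'n \<Rightarrow> 'm set" where
  "fibre F g = {f \<in> Arr (Src F). ArrMap F f = g}"

definition finite_fibres :: "('o, 'm, 'p, 'n) functor_data \<Rightarrow> bool" where
  "finite_fibres F \<longleftrightarrow> (\<forall>g \<in> Arr (Tgt F). finite (fibre F g))"

definition bijective_on_objects :: "('o, 'm, 'p, 'n) functor_data \<Rightarrow> bool" where
  "bijective_on_objects F \<longleftrightarrow> bij_betw (ObjMap F) (Obj (Src F)) (Obj (Tgt F))"


section \<open>Fine incidence algebras\<close>

text \<open>
  Functions on the set of maps are represented by extensional functions. Only the record type
  is taken from \<^theory>\<open>HOL-Algebra.Module\<close>, since the locale \<open>module\<close> requires a ring of
  scalars; the scalars here are the whole type \<open>'k\<close>.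
\<close>

definition fine_incidence_algebra :: "('o, 'm) cat_data \<Rightarrow> ('k::rig, 'm \<Rightarrow> 'k) module" where
  "fine_incidence_algebra C =
     \<lparr>carrier = extensional (Arr C),
      mult = (\<lambda>\<alpha> \<beta>. \<lambda>f\<in>Arr C. \<Sum>(g, h)\<in>factorizations C f. \<alpha> g * \<beta> h),
      one = (\<lambda>f\<in>Arr C. if f \<in> Idn C ` Obj C then 1 else 0),
      zero = (\<lambda>f\<in>Arr C. 0),
      add = (\<lambda>\<alpha> \<beta>. \<lambda>f\<in>Arr C. \<alpha> f + \<beta> f),
      smult = (\<lambda>c \<alpha>. \<lambda>f\<in>Arr C. c * \<alpha> f)\<rparr>"

definition linear_map :: "('k, 'a) module \<Rightarrow> ('k, 'b) module \<Rightarrow> ('a \<Rightarrow> 'b) \<Rightarrow> bool" where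
  "linear_map M N \<phi> \<longleftrightarrow>
     \<phi> \<in> carrier M \<rightarrow> carrier N \<and>
     \<phi> \<zero>\<^bsub>M\<^esub> = \<zero>\<^bsub>N\<^esub> \<and>
     (\<forall>x \<in> carrier M. \<forall>y \<in> carrier M. \<phi> (x \<oplus>\<^bsub>M\<^esub> y) = \<phi> x \<oplus>\<^bsub>N\<^esub> \<phi> y) \<and>
     (\<forall>c. \<forall>x \<in> carrier M. \<phi> (c \<odot>\<^bsub>M\<^esub> x) = c \<odot>\<^bsub>N\<^esub> \<phi> x)"

definition upper_star ::
  "('o, 'm, 'p, 'n) functor_data \<Rightarrow> ('n \<Rightarrow> 'k::rig) \<Rightarrow> ('m \<Rightarrow> 'k)" where
  "upper_star F \<beta> = (\<lambda>f\<in>Arr (Src F). \<beta> (ArrMap F f))"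

definition lower_shriek ::
  "('o, 'm, 'p, 'n) functor_data \<Rightarrow> ('m \<Rightarrow> 'k::rig) \<Rightarrow> ('n \<Rightarrow> 'k)" where
  "lower_shriek F \<alpha> = (\<lambda>g\<in>Arr (Tgt F). \<Sum>f\<in>fibre F g. \<alpha> f)"

end

theory Submission
  imports Defs
begin

text \<open>
  The maps of a category $X$ are the functors from the walking arrow $\bullet \to \bullet$ to $X$,
  naturally in $X$. So a map of a pullback $D$ in the category of categories is the same as a pair
  of a map $f$ of $A$ and a map $g$ of $B$ with $F f = G g$
  (\<open>pullback_CAT_ex1_map\<close>); applied to identities, this gives the corresponding description of
  objects. Composition in $D$ is then computed componentwise, since the two projections are
  functors and are jointly injective.

  With this description everything is elementary. A factorization of $G' d$ in $A$ is sent by $F$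
  to a factorization of $F G' d = G F' d$, which lifts uniquely to a factorization of
  $F' d$ because $G$ is ULF; pairing the two factorizations gives the one of $d$. A map of $D$ above a
  map $b$ of $B$ is determined by its component in $A$, which may be any map above $G b$: that is,
  $G'$ restricts to a bijection from the fibre of $F'$ over $b$ to the fibre of $F$ over $G b$
  (\<open>bij_betw_fibres\<close>). Finiteness of fibres therefore transfers from $F$ to $F'$, and at $b$ the two
  sides of the equation $G^* F_! \alpha = F'_! G'^* \alpha$ are the same sum, indexed by these two
  fibres. For the same reason there is exactly one object of $D$ above an object $b$ of $B$: its
  component in $A$ is the unique object above $G b$.
\<close>

section \<open>The walking arrow\<close>

text \<open>
  Any three distinct elements $x$, $y$, $z$ of the universe carry a copy of the walking arrow:
  $x$ and $y$ are the objects, each serving also as its own identity, and $z$ is the map from $x$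
  to $y$. In a composable pair \<open>(g, h)\<close> with \<open>g = z\<close> the map \<open>h\<close> is the identity \<open>y\<close>; otherwise
  \<open>g\<close> is an identity. This explains the formula for composition.
\<close>

definition walking_arrow :: "'u \<Rightarrow> 'u \<Rightarrow> 'u \<Rightarrow> 'u small_cat" where
  "walking_arrow x y z =
     \<lparr>Obj = {x, y}, Arr = {x, y, z},
      Dom = (\<lambda>f. if f = y then y else x), Cod = (\<lambda>f. if f = x then x else y),
      Idn = (\<lambda>a. a), Comp = (\<lambda>h g. if g = z then z else h)\<rparr>"

definition map_as_functor ::
  "'u \<Rightarrow> 'u \<Rightarrow> 'u \<Rightarrow> 'u small_cat \<Rightarrow> 'u \<Rightarrow> 'u small_functor" where
  "map_as_functor x y z X f =
     \<lparr>Src = walking_arrow x y z, Tgt = X,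
      ObjMap = (\<lambda>a\<in>{x, y}. if a = x then Dom X f else Cod X f),
      ArrMap = (\<lambda>m\<in>{x, y, z}.
        if m = x then Idn X (Dom X f) else if m = y then Idn X (Cod X f) else f)\<rparr>"

lemma category_walking_arrow:
  assumes "distinct [x, y, z]"
  shows "category (walking_arrow x y z)"
  using assms by unfold_locales (auto simp: walking_arrow_def split: if_splits)

lemma is_functor_map_as_functor:
  assumes "distinct [x, y, z]" "category X" "f \<in> Arr X"
  shows "is_functor (map_as_functor x y z X f)"
proof -
  interpret X: category X by fact
  have ends: "Dom X f \<in> Obj X" "Cod X f \<in> Obj X"
    using assms X.Dom_in_Obj X.Cod_in_Obj by auto
  have idem: "Comp X (Idn X a) (Idn X a) = Idn X a" if "a \<in> Obj X" for a
    using X.Comp_Idn_right[OF X.Idn_in_Arr[OF that]] X.Dom_Idn[OF that] by simp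
  show ?thesis
    using assms ends category_walking_arrow[OF assms(1)]
    by (auto simp: is_functor_def map_as_functor_def walking_arrow_def idem X.Idn_in_Arr
        X.Dom_Idn X.Cod_Idn X.Comp_Idn_left X.Comp_Idn_right)
qed

text \<open>Naturality of the correspondence between maps and functors from the walking arrow.\<close>

lemma functor_comp_map_as_functor:
  assumes "distinct [x, y, z]" "is_functor H" "f \<in> Arr (Src H)"
  shows "functor_comp H (map_as_functor x y z (Src H) f) =
    map_as_functor x y z (Tgt H) (ArrMap H f)"
proof -
  have "Dom (Src H) f \<in> Obj (Src H)" "Cod (Src H) f \<in> Obj (Src H)"
    using assms category.Dom_in_Obj category.Cod_in_Obj unfolding is_functor_def by auto
  then show ?thesis
    using assms
    by (auto simp: functor_comp_def map_as_functor_def walking_arrow_def is_functor_def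
        intro!: functor_data.equality ext)
qed

lemma map_as_functor_inject:
  assumes "distinct [x, y, z]" "map_as_functor x y z X f = map_as_functor x y z X g"
  shows "f = g"
proof -
  have "ArrMap (map_as_functor x y z X h) z = h" for h
    using assms(1) by (auto simp: map_as_functor_def)
  then show ?thesis
    using assms(2) by metis
qed


section \<open>Maps of a pullback of categories\<close>

text \<open>
  The universal property, tested on the walking arrow: an infinite universe contains three distinct
  elements, hence a copy of it. The maps $a$ and $b$ form a cone from the walking arrow, the map $d$ is
  the value at the generating map of the mediating functor, and uniqueness of $d$ is uniqueness of
  that functor.
\<close>

lemma pullback_CAT_ex1_map:
  fixes F G P Q :: "'u::infinite small_functor"
  assumes pb: "pullback_square CAT P Q F G"
    and a: "a \<in> Arr (Src F)" and b: "b \<in> Arr (Src G)" and eq: "ArrMap F a = ArrMap G b"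
  shows "\<exists>!d. d \<in> Arr (Src P) \<and> ArrMap P d = a \<and> ArrMap Q d = b"
proof -
  have fun_P: "is_functor P" and fun_Q: "is_functor Q"
    and fun_F: "is_functor F" and fun_G: "is_functor G"
    and src: "Src Q = Src P" "Tgt P = Src F" "Tgt Q = Src G" "Tgt G = Tgt F"
    using pb by (auto simp: pullback_square_def CAT_def)
  have cats: "category (Src F)" "category (Src G)" "category (Src P)"
    using fun_F fun_G fun_P by (auto simp: is_functor_def)
  obtain X :: "'u set" where "finite X" "card X = 3"
    using infinite_arbitrarily_large[OF infinite_UNIV] by blast
  then obtain x y z :: 'u where xyz: "distinct [x, y, z]"
    by (auto simp: card_3_iff)
  let ?S = "map_as_functor x y z (Src F) a" and ?T = "map_as_functor x y z (Src G) b"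
  let ?U = "map_as_functor x y z (Src P)"
  have "functor_comp F ?S = functor_comp G ?T"
    using functor_comp_map_as_functor[OF xyz fun_F a] functor_comp_map_as_functor[OF xyz fun_G b]
      eq src by simp
  then have "Comp CAT F ?S = Comp CAT G ?T"
    by (simp add: CAT_def)
  moreover have "?S \<in> Arr CAT" "?T \<in> Arr CAT"
    using is_functor_map_as_functor[OF xyz] cats a b by (auto simp: CAT_def)
  moreover have "Dom CAT ?S = Dom CAT ?T" "Cod CAT ?S = Dom CAT F" "Cod CAT ?T = Dom CAT G"
    by (simp_all add: CAT_def map_as_functor_def)
  ultimately have "\<exists>!u. u \<in> Arr CAT \<and> Dom CAT u = Dom CAT ?S \<and> Cod CAT u = Dom CAT P \<and>
      Comp CAT P u = ?S \<and> Comp CAT Q u = ?T"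
    using pb unfolding pullback_square_def by blast
  then have ex1: "\<exists>!u. is_functor u \<and> Src u = Src ?S \<and> Tgt u = Src P \<and>
      functor_comp P u = ?S \<and> functor_comp Q u = ?T"
    by (simp add: CAT_def)
  show ?thesis
  proof (rule ex_ex1I)
    from ex1 obtain u where u: "is_functor u" "Src u = Src ?S" "Tgt u = Src P"
      "functor_comp P u = ?S" "functor_comp Q u = ?T"
      by blast
    have z: "z \<in> Arr (Src u)"
      using u(2) by (simp add: map_as_functor_def walking_arrow_def)
    have "ArrMap P (ArrMap u z) = ArrMap (functor_comp P u) z"
      "ArrMap Q (ArrMap u z) = ArrMap (functor_comp Q u) z"
      using z by (simp_all add: functor_comp_def)
    moreover have "ArrMap ?S z = a" "ArrMap ?T z = b"
      using xyz by (auto simp: map_as_functor_def)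
    moreover have "ArrMap u z \<in> Arr (Src P)"
      using u(1,3) z by (auto simp: is_functor_def)
    ultimately show "\<exists>d. d \<in> Arr (Src P) \<and> ArrMap P d = a \<and> ArrMap Q d = b"
      using u(4,5) by auto
  next
    fix d e
    assume d: "d \<in> Arr (Src P) \<and> ArrMap P d = a \<and> ArrMap Q d = b"
      and e: "e \<in> Arr (Src P) \<and> ArrMap P e = a \<and> ArrMap Q e = b"
    have mediates: "is_functor (?U c) \<and> Src (?U c) = Src ?S \<and> Tgt (?U c) = Src P \<and>
        functor_comp P (?U c) = ?S \<and> functor_comp Q (?U c) = ?T"
      if "c \<in> Arr (Src P) \<and> ArrMap P c = a \<and> ArrMap Q c = b" for c
      using that is_functor_map_as_functor[OF xyz cats(3)]
        functor_comp_map_as_functor[OF xyz fun_P, of c]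
        functor_comp_map_as_functor[OF xyz fun_Q, of c] src
      by (auto simp: map_as_functor_def)
    have "?U d = ?U e"
      using ex1 mediates[OF d] mediates[OF e] by blast
    then show "d = e"
      by (rule map_as_functor_inject[OF xyz])
  qed
qed

text \<open>
  A square of functors that is a pullback on maps is a pullback of categories: objects correspond
  to identities, and composites are compared by their two components.
\<close>

locale mapwise_pullback =
  fixes A B C D :: "('o, 'm) cat_data"
    and F F' G G' :: "('o, 'm, 'o, 'm) functor_data"
  assumes ends: "Src F = A" "Tgt F = C" "Src G = B" "Tgt G = C"
      "Src F' = D" "Tgt F' = B" "Src G' = D" "Tgt G' = A"
    and functors: "is_functor F" "is_functor F'" "is_functor G" "is_functor G'"
    and square: "d \<in> Arr D \<Longrightarrow> ArrMap F (ArrMap G' d) = ArrMap G (ArrMap F' d)"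
    and ex1_map: "\<lbrakk>a \<in> Arr A; b \<in> Arr B; ArrMap F a = ArrMap G b\<rbrakk>
      \<Longrightarrow> \<exists>!d. d \<in> Arr D \<and> ArrMap G' d = a \<and> ArrMap F' d = b"

lemma mapwise_pullback_CAT:
  fixes A B C D :: "'u::infinite small_cat"
  assumes "Src F = A" "Tgt F = C" "Src G = B" "Tgt G = C"
    and "Src F' = D" "Tgt F' = B" "Src G' = D" "Tgt G' = A"
    and pb: "pullback_square CAT G' F' F G"
  shows "mapwise_pullback A B C D F F' G G'"
proof
  show "is_functor F" "is_functor F'" "is_functor G" "is_functor G'"
    using pb by (auto simp: pullback_square_def CAT_def)
  have "functor_comp F G' = functor_comp G F'"
    using pb by (simp add: pullback_square_def CAT_def)
  moreover have "ArrMap (functor_comp F G') d = ArrMap F (ArrMap G' d)"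
    "ArrMap (functor_comp G F') d = ArrMap G (ArrMap F' d)" if "d \<in> Arr D" for d
    using that assms(5,7) by (simp_all add: functor_comp_def)
  ultimately show "ArrMap F (ArrMap G' d) = ArrMap G (ArrMap F' d)" if "d \<in> Arr D" for d
    using that by metis
  show "\<exists>!d. d \<in> Arr D \<and> ArrMap G' d = a \<and> ArrMap F' d = b"
    if "a \<in> Arr A" "b \<in> Arr B" "ArrMap F a = ArrMap G b" for a b
    using pullback_CAT_ex1_map[OF pb] that assms by auto
qed (use assms in auto)

lemma ex1_pairE:
  assumes "\<exists>!(x, y). R x y"
  obtains x y where "R x y" "\<And>x' y'. R x' y' \<Longrightarrow> x' = x \<and> y' = y"
proof -
  from assms obtain p where p: "case p of (x, y) \<Rightarrow> R x y"
    and unique: "\<And>q. (case q of (x, y) \<Rightarrow> R x y) \<Longrightarrow> q = p"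
    by (elim ex1E) blast
  obtain x y where "p = (x, y)"
    by (cases p)
  with p unique show ?thesis
    by (intro that[of x y]) auto
qed

lemma is_functorD:
  assumes "is_functor H"
  shows "category (Src H)" "category (Tgt H)"
    and "a \<in> Obj (Src H) \<Longrightarrow> ObjMap H a \<in> Obj (Tgt H)"
    and "f \<in> Arr (Src H) \<Longrightarrow> ArrMap H f \<in> Arr (Tgt H)"
    and "f \<in> Arr (Src H) \<Longrightarrow> Dom (Tgt H) (ArrMap H f) = ObjMap H (Dom (Src H) f)"
    and "f \<in> Arr (Src H) \<Longrightarrow> Cod (Tgt H) (ArrMap H f) = ObjMap H (Cod (Src H) f)"
    and "a \<in> Obj (Src H) \<Longrightarrow> ArrMap H (Idn (Src H) a) = Idn (Tgt H) (ObjMap H a)"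
    and "\<lbrakk>f \<in> Arr (Src H); g \<in> Arr (Src H); Cod (Src H) f = Dom (Src H) g\<rbrakk>
      \<Longrightarrow> ArrMap H (Comp (Src H) g f) = Comp (Tgt H) (ArrMap H g) (ArrMap H f)"
  using assms by (auto simp: is_functor_def)

lemma factorizations_ArrMap:
  assumes "is_functor H" "(g, h) \<in> factorizations (Src H) f"
  shows "(ArrMap H g, ArrMap H h) \<in> factorizations (Tgt H) (ArrMap H f)"
  using assms(2) by (auto simp: factorizations_def is_functorD(4-6,8)[OF assms(1)])

context mapwise_pullback
begin

lemmas F = is_functorD[OF functors(1), unfolded ends]
  and F' = is_functorD[OF functors(2), unfolded ends]
  and G = is_functorD[OF functors(3), unfolded ends]
  and G' = is_functorD[OF functors(4), unfolded ends]

lemma map_eqI: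
  assumes "d \<in> Arr D" "e \<in> Arr D" "ArrMap G' d = ArrMap G' e" "ArrMap F' d = ArrMap F' e"
  shows "d = e"
proof -
  have "\<exists>!c. c \<in> Arr D \<and> ArrMap G' c = ArrMap G' e \<and> ArrMap F' c = ArrMap F' e"
    by (intro ex1_map F'(4) G'(4) square assms(2))
  then show ?thesis
    using assms by blast
qed

text \<open>Objects are compared through their identities.\<close>

lemma object_eqI:
  assumes "x \<in> Obj D" "y \<in> Obj D" "ObjMap G' x = ObjMap G' y" "ObjMap F' x = ObjMap F' y"
  shows "x = y"
proof -
  interpret D: category D by (rule F'(1))
  have "Idn D x = Idn D y"
    by (rule map_eqI) (simp_all add: assms D.Idn_in_Arr F'(7) G'(7))
  then show ?thesis
    using D.Dom_Idn assms(1,2) by metis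
qed

lemma object_exists:
  assumes "a \<in> Obj A" "b \<in> Obj B" "ObjMap F a = ObjMap G b"
  shows "\<exists>x \<in> Obj D. ObjMap G' x = a \<and> ObjMap F' x = b"
proof -
  interpret A: category A by (rule F(1))
  interpret B: category B by (rule G(1))
  have "\<exists>!d. d \<in> Arr D \<and> ArrMap G' d = Idn A a \<and> ArrMap F' d = Idn B b"
    using assms by (intro ex1_map) (simp_all add: A.Idn_in_Arr B.Idn_in_Arr F(7) G(7))
  then obtain d where d: "d \<in> Arr D" "ArrMap G' d = Idn A a" "ArrMap F' d = Idn B b"
    by blast
  have "ObjMap G' (Dom D d) = a"
    using G'(5)[OF d(1)] d(2) A.Dom_Idn[OF assms(1)] by simp
  moreover have "ObjMap F' (Dom D d) = b"
    using F'(5)[OF d(1)] d(3) B.Dom_Idn[OF assms(2)] by simp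
  ultimately show ?thesis
    using category.Dom_in_Obj[OF F'(1) d(1)] by blast
qed

lemma object_square:
  assumes "x \<in> Obj D"
  shows "ObjMap F (ObjMap G' x) = ObjMap G (ObjMap F' x)"
proof -
  interpret D: category D by (rule F'(1))
  have i: "Idn D x \<in> Arr D" "Dom D (Idn D x) = x"
    using assms by (simp_all add: D.Idn_in_Arr D.Dom_Idn)
  have "Dom C (ArrMap F (ArrMap G' (Idn D x))) = ObjMap F (ObjMap G' x)"
    using i by (simp add: F(5) G'(4,5))
  moreover have "Dom C (ArrMap G (ArrMap F' (Idn D x))) = ObjMap G (ObjMap F' x)"
    using i by (simp add: G(5) F'(4,5))
  ultimately show ?thesis
    using square[OF i(1)] by simp
qed

text \<open>Factorizations in the pullback can be assembled from their two components.\<close>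

lemma factorizationsI:
  assumes "d \<in> Arr D" "d1 \<in> Arr D" "d2 \<in> Arr D"
    and a: "(ArrMap G' d1, ArrMap G' d2) \<in> factorizations A (ArrMap G' d)"
    and b: "(ArrMap F' d1, ArrMap F' d2) \<in> factorizations B (ArrMap F' d)"
  shows "(d1, d2) \<in> factorizations D d"
proof -
  interpret D: category D by (rule F'(1))
  have composable: "Cod D d1 = Dom D d2"
    by (rule object_eqI) (use assms in
      \<open>auto simp: factorizations_def D.Dom_in_Obj D.Cod_in_Obj F'(5,6) G'(5,6)\<close>)
  have "Comp D d2 d1 = d"
    by (rule map_eqI[OF _ assms(1)])
      (use assms composable in \<open>auto simp: factorizations_def D.Comp_in_Arr F'(8) G'(8)\<close>)
  with composable assms(2,3) show ?thesis
    by (simp add: factorizations_def)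
qed


section \<open>Stability under pullback\<close>

lemma ULF_pullback:
  assumes "ULF G"
  shows "ULF G'"
  unfolding ULF_def ends
proof (intro ballI, clarify)
  fix d a1 a2
  assume d: "d \<in> Arr D" and a: "(a1, a2) \<in> factorizations A (ArrMap G' d)"
  have a_arr: "a1 \<in> Arr A" "a2 \<in> Arr A"
    using a by (auto simp: factorizations_def)
  have "(ArrMap F a1, ArrMap F a2) \<in> factorizations C (ArrMap G (ArrMap F' d))"
    using factorizations_ArrMap[OF functors(1), unfolded ends, OF a] square[OF d] by simp
  then have "\<exists>!(b1, b2). (b1, b2) \<in> factorizations B (ArrMap F' d) \<and>
      ArrMap G b1 = ArrMap F a1 \<and> ArrMap G b2 = ArrMap F a2"
    using assms F'(4)[OF d] unfolding ULF_def ends by fast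
  then obtain b1 b2 where b: "(b1, b2) \<in> factorizations B (ArrMap F' d) \<and>
      ArrMap G b1 = ArrMap F a1 \<and> ArrMap G b2 = ArrMap F a2"
    and b_unique: "\<And>c1 c2. (c1, c2) \<in> factorizations B (ArrMap F' d) \<and>
      ArrMap G c1 = ArrMap F a1 \<and> ArrMap G c2 = ArrMap F a2 \<Longrightarrow> c1 = b1 \<and> c2 = b2"
    by (rule ex1_pairE) (erule that, blast)
  have b_arr: "b1 \<in> Arr B" "b2 \<in> Arr B"
    using b by (auto simp: factorizations_def)
  obtain d1 where d1: "d1 \<in> Arr D" "ArrMap G' d1 = a1" "ArrMap F' d1 = b1"
    using ex1_map[of a1 b1] a_arr b_arr b by auto
  obtain d2 where d2: "d2 \<in> Arr D" "ArrMap G' d2 = a2" "ArrMap F' d2 = b2"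
    using ex1_map[of a2 b2] a_arr b_arr b by auto
  have d12: "(d1, d2) \<in> factorizations D d"
    using factorizationsI d d1 d2 a b by simp
  have unique: "e1 = d1 \<and> e2 = d2"
    if e: "(e1, e2) \<in> factorizations D d" "ArrMap G' e1 = a1" "ArrMap G' e2 = a2" for e1 e2
  proof -
    have e_arr: "e1 \<in> Arr D" "e2 \<in> Arr D"
      using e(1) by (auto simp: factorizations_def)
    have "ArrMap F' e1 = b1 \<and> ArrMap F' e2 = b2"
      using factorizations_ArrMap[OF functors(2), unfolded ends, OF e(1)]
        square[OF e_arr(1)] square[OF e_arr(2)] e(2,3)
      by (intro b_unique) auto
    then show ?thesis
      using map_eqI e_arr e(2,3) d1 d2 by auto
  qed
  show "\<exists>!(f1, f2). (f1, f2) \<in> factorizations D d \<and> ArrMap G' f1 = a1 \<and> ArrMap G' f2 = a2"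
    (is "\<exists>!p. ?lift p")
  proof (rule ex1I)
    show "?lift (d1, d2)"
      using d12 d1(2) d2(2) by simp
    show "p = (d1, d2)" if "?lift p" for p
      using that unique[of "fst p" "snd p"] by (cases p) simp
  qed
qed

lemma bijective_on_objects_pullback:
  assumes "bijective_on_objects F"
  shows "bijective_on_objects F'"
  unfolding bijective_on_objects_def bij_betw_def ends
proof
  have F_inj: "inj_on (ObjMap F) (Obj A)" and F_onto: "ObjMap F ` Obj A = Obj C"
    using assms unfolding bijective_on_objects_def bij_betw_def ends by auto
  show "inj_on (ObjMap F') (Obj D)"
  proof (rule inj_onI)
    fix x y
    assume xy: "x \<in> Obj D" "y \<in> Obj D" "ObjMap F' x = ObjMap F' y"
    then have "ObjMap F (ObjMap G' x) = ObjMap F (ObjMap G' y)"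
      by (simp add: object_square)
    then have "ObjMap G' x = ObjMap G' y"
      using F_inj G'(3) xy by (auto dest: inj_onD)
    then show "x = y"
      using object_eqI xy by blast
  qed
  have "\<exists>x \<in> Obj D. ObjMap F' x = b" if "b \<in> Obj B" for b
    using object_exists[OF _ that] F_onto G(3)[OF that] by (metis imageE)
  then show "ObjMap F' ` Obj D = Obj B"
    using F'(3) by blast
qed

text \<open>
  The component in $B$ of a map above $b$ is $b$ itself, so only the component in $A$ is free, and
  the one condition on it is to lie above $G b$.
\<close>

lemma bij_betw_fibres:
  assumes "b \<in> Arr B"
  shows "bij_betw (ArrMap G') (fibre F' b) (fibre F (ArrMap G b))"
  unfolding bij_betw_def
proof
  show "inj_on (ArrMap G') (fibre F' b)"
    using map_eqI by (force intro: inj_onI simp: fibre_def ends)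
  show "ArrMap G' ` fibre F' b = fibre F (ArrMap G b)"
  proof
    show "ArrMap G' ` fibre F' b \<subseteq> fibre F (ArrMap G b)"
      using G'(4) square by (auto simp: fibre_def ends)
    show "fibre F (ArrMap G b) \<subseteq> ArrMap G' ` fibre F' b"
    proof
      fix a
      assume "a \<in> fibre F (ArrMap G b)"
      then obtain d where "d \<in> Arr D" "ArrMap G' d = a" "ArrMap F' d = b"
        using ex1_map[of a b] assms by (auto simp: fibre_def ends)
      then show "a \<in> ArrMap G' ` fibre F' b"
        by (auto simp: fibre_def ends)
    qed
  qed
qed

lemma finite_fibres_pullback:
  assumes "finite_fibres F"
  shows "finite_fibres F'"
  using assms bij_betw_finite[OF bij_betw_fibres] G(4)
  unfolding finite_fibres_def ends by blast

lemma upper_star_lower_shriek: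
  "upper_star G (lower_shriek F \<alpha>) = lower_shriek F' (upper_star G' \<alpha>)"
proof
  fix b
  show "upper_star G (lower_shriek F \<alpha>) b = lower_shriek F' (upper_star G' \<alpha>) b"
  proof (cases "b \<in> Arr B")
    case True
    have "upper_star G (lower_shriek F \<alpha>) b = (\<Sum>a\<in>fibre F (ArrMap G b). \<alpha> a)"
      using True G(4) by (simp add: upper_star_def lower_shriek_def ends)
    also have "\<dots> = (\<Sum>d\<in>fibre F' b. \<alpha> (ArrMap G' d))"
      using sum.reindex_bij_betw[OF bij_betw_fibres[OF True], of \<alpha>] by simp
    also have "\<dots> = (\<Sum>d\<in>fibre F' b. upper_star G' \<alpha> d)"
      by (rule sum.cong) (auto simp: upper_star_def fibre_def ends)
    also have "\<dots> = lower_shriek F' (upper_star G' \<alpha>) b"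
      using True by (simp add: lower_shriek_def ends)
    finally show ?thesis .
  next
    case False
    then show ?thesis
      by (simp add: upper_star_def lower_shriek_def ends)
  qed
qed

end


section \<open>Linearity\<close>

lemma linear_map_upper_star:
  assumes "is_functor F"
  shows "linear_map (fine_incidence_algebra (Tgt F)) (fine_incidence_algebra (Src F))
    (upper_star F :: ('n \<Rightarrow> 'k::rig) \<Rightarrow> _)"
  using is_functorD(4)[OF assms]
  by (auto simp: linear_map_def fine_incidence_algebra_def upper_star_def intro!: ext)

lemma linear_map_lower_shriek:
  "linear_map (fine_incidence_algebra (Src F)) (fine_incidence_algebra (Tgt F))
    (lower_shriek F :: ('m \<Rightarrow> 'k::rig) \<Rightarrow> _)"
proof -
  \<comment> \<open>Fibres consist of maps, so restricted functions never take their default value there.\<close>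
  have fibre_sum: "(\<Sum>f\<in>fibre F g. if f \<in> Arr (Src F) then \<alpha> f else undefined) =
      (\<Sum>f\<in>fibre F g. \<alpha> f)" for g and \<alpha> :: "'m \<Rightarrow> 'k"
    by (rule sum.cong) (auto simp: fibre_def)
  show ?thesis
    by (auto simp: linear_map_def fine_incidence_algebra_def lower_shriek_def fibre_sum
        sum.distrib sum_distrib_left intro!: ext)
qed


section \<open>The Beck--Chevalley condition\<close>

theorem theorem5p1:
  fixes A B C D :: "'u::infinite small_cat"
    and F F' G G' :: "'u small_functor"
  assumes "Src F = A" "Tgt F = C"
    and "Src G = B" "Tgt G = C"
    and "Src F' = D" "Tgt F' = B"
    and "Src G' = D" "Tgt G' = A"
    and "pullback_square CAT G' F' F G"
    and "finely_finite A" "finely_finite B" "finely_finite C" "finely_finite D"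
    and "ULF G"
    and "bijective_on_objects F" "finite_fibres F"
  shows "ULF G' \<and> bijective_on_objects F' \<and> finite_fibres F' \<and>
    (let kA = fine_incidence_algebra A :: ('k::rig, 'u \<Rightarrow> 'k) module;
         kB = fine_incidence_algebra B :: ('k, 'u \<Rightarrow> 'k) module;
         kC = fine_incidence_algebra C :: ('k, 'u \<Rightarrow> 'k) module;
         kD = fine_incidence_algebra D :: ('k, 'u \<Rightarrow> 'k) module
     in linear_map kA kC (lower_shriek F) \<and>
        linear_map kD kB (lower_shriek F') \<and>
        linear_map kC kB (upper_star G) \<and>
        linear_map kA kD (upper_star G') \<and>
        (\<forall>\<alpha> \<in> carrier kA.
           upper_star G (lower_shriek F \<alpha>) = lower_shriek F' (upper_star G' \<alpha>)))"
proof -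
  interpret mapwise_pullback A B C D F F' G G'
    by (rule mapwise_pullback_CAT) fact+
  have "linear_map (fine_incidence_algebra A) (fine_incidence_algebra C)
      (lower_shriek F :: ('u \<Rightarrow> 'k) \<Rightarrow> _)"
    "linear_map (fine_incidence_algebra D) (fine_incidence_algebra B)
      (lower_shriek F' :: ('u \<Rightarrow> 'k) \<Rightarrow> _)"
    "linear_map (fine_incidence_algebra C) (fine_incidence_algebra B)
      (upper_star G :: ('u \<Rightarrow> 'k) \<Rightarrow> _)"
    "linear_map (fine_incidence_algebra A) (fine_incidence_algebra D)
      (upper_star G' :: ('u \<Rightarrow> 'k) \<Rightarrow> _)"
    using linear_map_lower_shriek[of F] linear_map_lower_shriek[of F']
      linear_map_upper_star[OF functors(3)] linear_map_upper_star[OF functors(4)]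
    unfolding ends .
  then show ?thesis
    using ULF_pullback bijective_on_objects_pullback finite_fibres_pullback assms(14-16)
    by (simp add: Let_def upper_star_lower_shriek)
qed

end
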